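(* Let $\{V_n\}_{n\ge 0}$ be a generalized Tribonacci sequence with parameters $r,s,t$, let $\{O_{v,n}\}_{n\ge 0}$ be the associated generalized Tribonacci octonions, and let $\delta=\delta_{r,s,t}=r+s+t-1$, assumed nonzero. Then for every integer $n\ge 0$, $$\sum_{l=0}^{n}O_{v,l}=\frac{1}{\delta_{r,s,t}}\bigl(O_{v,n+2}+(1-r)O_{v,n+1}+tO_{v,n}+\omega_{r,s,t}\bigr),$$ where $\lambda_{r,s,t}=(r+s-1)V_{0}+(r-1)V_{1}-V_{2}$ and $$\omega_{r,s,t}=\lambda_{r,s,t}+\sum_{j=1}^{7}\bigl(\lambda_{r,s,t}-\delta(V_0+V_1+\cdots+V_{j-1})\bigr)e_j .$$
   Context: Generalized Tribonacci sequence: $r,s,t$ are real numbers, $V_0,V_1,V_2$ are arbitrary integers, and $V_n=rV_{n-1}+sV_{n-2}+tV_{n-3}$ for $n\ge 3$. Standing assumption: $\Delta=\frac{r^{3}t}{27}-\frac{r^{2}s^{2}}{108}+\frac{rst}{6}-\frac{s^{3}}{27}+\frac{t^{2}}{4}>0$, so that $x^3-rx^2-sx-t=0$ has one real root and two nonreal complex conjugate roots. Octonions: $\mathbb{O}$ is the real octonion algebra, an $8$-dimensional real vector space with basis $e_0=\mathbf{1},e_1,\dots,e_7$; a real number $a$ is identified with $ae_0$. The $n$-th generalized Tribonacci octonion is $O_{v,n}=\sum_{l=0}^{7}V_{n+l}e_l=V_n+\sum_{l=1}^{7}V_{n+l}e_l$, $n\ge 0$. *)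

theory Defs
  imports Complex_Main
begin

datatype octonion = Octonion
  (oc0: real) (oc1: real) (oc2: real) (oc3: real) (oc4: real) (oc5: real) (oc6: real) (oc7: real)

lemma octonion_eq_iff:
  "x = y \<longleftrightarrow> oc0 x = oc0 y \<and> oc1 x = oc1 y \<and> oc2 x = oc2 y \<and> oc3 x = oc3 y \<and>
             oc4 x = oc4 y \<and> oc5 x = oc5 y \<and> oc6 x = oc6 y \<and> oc7 x = oc7 y"
  by (cases x; cases y) simp

instantiation octonion :: real_vector
begin

definition zero_octonion :: octonion where
  "0 = Octonion 0 0 0 0 0 0 0 0"

definition plus_octonion :: "octonion \<Rightarrow> octonion \<Rightarrow> octonion" where
  "x + y = Octonion (oc0 x + oc0 y) (oc1 x + oc1 y) (oc2 x + oc2 y) (oc3 x + oc3 y)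
                    (oc4 x + oc4 y) (oc5 x + oc5 y) (oc6 x + oc6 y) (oc7 x + oc7 y)"

definition uminus_octonion :: "octonion \<Rightarrow> octonion" where
  "- x = Octonion (- oc0 x) (- oc1 x) (- oc2 x) (- oc3 x) (- oc4 x) (- oc5 x) (- oc6 x) (- oc7 x)"

definition minus_octonion :: "octonion \<Rightarrow> octonion \<Rightarrow> octonion" where
  "x - y = Octonion (oc0 x - oc0 y) (oc1 x - oc1 y) (oc2 x - oc2 y) (oc3 x - oc3 y)
                    (oc4 x - oc4 y) (oc5 x - oc5 y) (oc6 x - oc6 y) (oc7 x - oc7 y)"

definition scaleR_octonion :: "real \<Rightarrow> octonion \<Rightarrow> octonion" where
  "c *\<^sub>R x = Octonion (c * oc0 x) (c * oc1 x) (c * oc2 x) (c * oc3 x)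
                     (c * oc4 x) (c * oc5 x) (c * oc6 x) (c * oc7 x)"

instance
  by standard
    (simp_all add: octonion_eq_iff zero_octonion_def plus_octonion_def uminus_octonion_def
       minus_octonion_def scaleR_octonion_def algebra_simps)

end

instantiation octonion :: "{one, times}"
begin

definition one_octonion :: octonion where
  "1 = Octonion 1 0 0 0 0 0 0 0"

(* The product with e_i * e_j = e_k for (i,j,k) a cyclic shift of one of
   123, 145, 176, 246, 257, 347, 365; swapping i and j changes the sign, and e_i * e_i = -1. *)
definition times_octonion :: "octonion \<Rightarrow> octonion \<Rightarrow> octonion" where
  "x * y = Octonion
     (oc0 x * oc0 y - oc1 x * oc1 y - oc2 x * oc2 y - oc3 x * oc3 y
       - oc4 x * oc4 y - oc5 x * oc5 y - oc6 x * oc6 y - oc7 x * oc7 y)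
     (oc0 x * oc1 y + oc1 x * oc0 y + oc2 x * oc3 y - oc3 x * oc2 y
       + oc4 x * oc5 y - oc5 x * oc4 y + oc7 x * oc6 y - oc6 x * oc7 y)
     (oc0 x * oc2 y + oc2 x * oc0 y + oc3 x * oc1 y - oc1 x * oc3 y
       + oc4 x * oc6 y - oc6 x * oc4 y + oc5 x * oc7 y - oc7 x * oc5 y)
     (oc0 x * oc3 y + oc3 x * oc0 y + oc1 x * oc2 y - oc2 x * oc1 y
       + oc4 x * oc7 y - oc7 x * oc4 y + oc6 x * oc5 y - oc5 x * oc6 y)
     (oc0 x * oc4 y + oc4 x * oc0 y + oc5 x * oc1 y - oc1 x * oc5 y
       + oc6 x * oc2 y - oc2 x * oc6 y + oc7 x * oc3 y - oc3 x * oc7 y)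
     (oc0 x * oc5 y + oc5 x * oc0 y + oc1 x * oc4 y - oc4 x * oc1 y
       + oc7 x * oc2 y - oc2 x * oc7 y + oc3 x * oc6 y - oc6 x * oc3 y)
     (oc0 x * oc6 y + oc6 x * oc0 y + oc1 x * oc7 y - oc7 x * oc1 y
       + oc2 x * oc4 y - oc4 x * oc2 y + oc5 x * oc3 y - oc3 x * oc5 y)
     (oc0 x * oc7 y + oc7 x * oc0 y + oc6 x * oc1 y - oc1 x * oc6 y
       + oc2 x * oc5 y - oc5 x * oc2 y + oc3 x * oc4 y - oc4 x * oc3 y)"

instance ..

end

definition oct_basis :: "nat \<Rightarrow> octonion" where
  "oct_basis l = Octonion (of_bool (l = 0)) (of_bool (l = 1)) (of_bool (l = 2)) (of_bool (l = 3))
                          (of_bool (l = 4)) (of_bool (l = 5)) (of_bool (l = 6)) (of_bool (l = 7))"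

lemma oct_basis_0: "oct_basis 0 = 1"
  by (simp add: oct_basis_def one_octonion_def)

lemma sum_oct_basis:
  "(\<Sum>l=0..7. c l *\<^sub>R oct_basis l) = Octonion (c 0) (c 1) (c 2) (c 3) (c 4) (c 5) (c 6) (c 7)"
  by (simp add: numeral_eq_Suc oct_basis_def scaleR_octonion_def plus_octonion_def
        zero_octonion_def)

lemma octonion_one_times:
  fixes x :: octonion
  shows "1 * x = x" and "x * 1 = x"
  by (simp_all add: octonion_eq_iff times_octonion_def one_octonion_def)

lemma octonion_times_bilinear:
  fixes x y z :: octonion
  shows "(x + y) * z = x * z + y * z" and "x * (y + z) = x * y + x * z"
    and "(c *\<^sub>R x) * y = c *\<^sub>R (x * y)" and "x * (c *\<^sub>R y) = c *\<^sub>R (x * y)"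
  by (simp_all add: octonion_eq_iff times_octonion_def plus_octonion_def scaleR_octonion_def
        algebra_simps)

definition oct_normsq :: "octonion \<Rightarrow> real" where
  "oct_normsq x = (oc0 x)\<^sup>2 + (oc1 x)\<^sup>2 + (oc2 x)\<^sup>2 + (oc3 x)\<^sup>2
                + (oc4 x)\<^sup>2 + (oc5 x)\<^sup>2 + (oc6 x)\<^sup>2 + (oc7 x)\<^sup>2"

(* By Hurwitz' theorem, this together with the bilinearity and the unit above
   determines the eight-dimensional real algebra up to isomorphism. *)
lemma oct_normsq_times: "oct_normsq (x * y) = oct_normsq x * oct_normsq y"
  by (cases x; cases y) (simp add: oct_normsq_def times_octonion_def power2_eq_square algebra_simps)

definition oct_of_real :: "real \<Rightarrow> octonion" where
  "oct_of_real a = a *\<^sub>R 1"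

definition gen_tribonacci :: "real \<Rightarrow> real \<Rightarrow> real \<Rightarrow> (nat \<Rightarrow> real) \<Rightarrow> bool" where
  "gen_tribonacci r s t V \<longleftrightarrow>
     V 0 \<in> \<int> \<and> V 1 \<in> \<int> \<and> V 2 \<in> \<int> \<and>
     (\<forall>n\<ge>3. V n = r * V (n - 1) + s * V (n - 2) + t * V (n - 3))"

definition tribonacci_disc :: "real \<Rightarrow> real \<Rightarrow> real \<Rightarrow> real" where
  "tribonacci_disc r s t =
     r ^ 3 * t / 27 - r\<^sup>2 * s\<^sup>2 / 108 + r * s * t / 6 - s ^ 3 / 27 + t\<^sup>2 / 4"

definition trib_octonion :: "(nat \<Rightarrow> real) \<Rightarrow> nat \<Rightarrow> octonion" where
  "trib_octonion V n = (\<Sum>l=0..7. V (n + l) *\<^sub>R oct_basis l)"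

definition trib_delta :: "real \<Rightarrow> real \<Rightarrow> real \<Rightarrow> real" where
  "trib_delta r s t = r + s + t - 1"

definition trib_lambda :: "real \<Rightarrow> real \<Rightarrow> real \<Rightarrow> (nat \<Rightarrow> real) \<Rightarrow> real" where
  "trib_lambda r s t V = (r + s - 1) * V 0 + (r - 1) * V 1 - V 2"

definition trib_omega :: "real \<Rightarrow> real \<Rightarrow> real \<Rightarrow> (nat \<Rightarrow> real) \<Rightarrow> octonion" where
  "trib_omega r s t V =
     oct_of_real (trib_lambda r s t V)
     + (\<Sum>j=1..7. (trib_lambda r s t V - trib_delta r s t * (\<Sum>i<j. V i)) *\<^sub>R oct_basis j)"

end

theory Submission
  imports Defs
begin

text \<open>
  The coefficient of \<open>e\<^sub>j\<close> in the sum is the window sum \<open>V j + \<dots> + V (j + n)\<close>, and the statement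
  is a closed form for such window sums, read off in all eight coordinates at once.
  The closed form comes from telescoping: the recurrence says exactly that
  \<open>\<delta> V (m + 1)\<close> is the increment, from \<open>m\<close> to \<open>m + 1\<close>, of \<open>V (m + 2) + (1 - r) V (m + 1) + t V m\<close>.
  Summing from the start of the sequence leaves the boundary constant \<open>\<lambda>\<close>; a window that starts
  at \<open>j\<close> is a partial sum from which the first \<open>j\<close> terms are removed, which produces the
  correction \<open>- \<delta> (V 0 + \<dots> + V (j - 1))\<close> in \<open>\<omega>\<close>. The hypothesis \<open>\<delta> \<noteq> 0\<close> serves to divide
  at the very end.
\<close>

lemma gen_tribonacci_step:
  assumes "gen_tribonacci r s t V"
  shows "V (m + 3) = r * V (m + 2) + s * V (m + 1) + t * V m"
proof -
  have "V (m + 3) = r * V (m + 3 - 1) + s * V (m + 3 - 2) + t * V (m + 3 - 3)"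
    using assms unfolding gen_tribonacci_def by (metis le_add2)
  then show ?thesis by (simp add: numeral_eq_Suc)
qed

text \<open>
  The constant \<open>\<lambda>\<close> is chosen to make the formula right at \<open>m = 0\<close>; from there both sides grow
  by \<open>\<delta> V (m + 1)\<close>, since the recurrence turns \<open>V (m + 3) - t V m\<close> into
  \<open>r V (m + 2) + s V (m + 1)\<close>.
\<close>
lemma tribonacci_partial_sum:
  assumes "gen_tribonacci r s t V"
  shows "trib_delta r s t * (\<Sum>i\<le>m. V i) =
    V (m + 2) + (1 - r) * V (m + 1) + t * V m + trib_lambda r s t V"
proof (induction m)
  case 0
  show ?case
    by (simp add: trib_delta_def trib_lambda_def algebra_simps flip: numeral_2_eq_2)
next
  case (Suc m)
  have "trib_delta r s t * (\<Sum>i\<le>Suc m. V i) =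
      V (m + 2) + (1 - r) * V (m + 1) + t * V m + trib_lambda r s t V
      + trib_delta r s t * V (m + 1)"
    using Suc.IH by (simp add: distrib_left)
  also have "\<dots> = V (m + 3) + (1 - r) * V (m + 2) + t * V (m + 1) + trib_lambda r s t V"
    unfolding gen_tribonacci_step[OF assms] trib_delta_def by (simp add: algebra_simps)
  finally show ?case by (simp add: numeral_eq_Suc)
qed

lemma tribonacci_window_sum:
  assumes "gen_tribonacci r s t V"
  shows "trib_delta r s t * (\<Sum>l=0..n. V (l + j)) =
    V (n + 2 + j) + (1 - r) * V (n + 1 + j) + t * V (n + j)
    + (trib_lambda r s t V - trib_delta r s t * (\<Sum>i<j. V i))"
proof -
  have "(\<Sum>i\<le>n + j. V i) = (\<Sum>i<j. V i) + (\<Sum>l=0..n. V (l + j))"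
    by (induction n) (simp_all add: lessThan_Suc_atMost[symmetric])
  then have "trib_delta r s t * (\<Sum>l=0..n. V (l + j)) =
      trib_delta r s t * (\<Sum>i\<le>n + j. V i) - trib_delta r s t * (\<Sum>i<j. V i)"
    by (simp add: distrib_left)
  also note tribonacci_partial_sum[OF assms]
  finally show ?thesis by (simp add: add_ac)
qed

text \<open>
  The real summand \<open>\<lambda>\<close> of \<open>\<omega>\<close> is the \<open>j = 0\<close> instance of its general coefficient, the correction
  being an empty sum; hence the real coordinate needs no separate treatment.
\<close>
lemma trib_omega_eq_sum:
  "trib_omega r s t V =
    (\<Sum>j=0..7. (trib_lambda r s t V - trib_delta r s t * (\<Sum>i<j. V i)) *\<^sub>R oct_basis j)"
  unfolding trib_omega_def oct_of_real_def
  by (subst sum.atLeast_Suc_atMost[of 0 7]) (simp_all add: oct_basis_0)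

theorem theorem3p3:
  fixes r s t :: real and V :: "nat \<Rightarrow> real" and n :: nat
  assumes "gen_tribonacci r s t V"
    and "tribonacci_disc r s t > 0"
    and "trib_delta r s t \<noteq> 0"
  shows "(\<Sum>l=0..n. trib_octonion V l) =
    (1 / trib_delta r s t) *\<^sub>R
      (trib_octonion V (n + 2) + (1 - r) *\<^sub>R trib_octonion V (n + 1)
        + t *\<^sub>R trib_octonion V n + trib_omega r s t V)"
proof -
  let ?d = "trib_delta r s t"
  have "(\<Sum>l=0..n. trib_octonion V l) = (\<Sum>j=0..7. (\<Sum>l=0..n. V (l + j)) *\<^sub>R oct_basis j)"
    unfolding trib_octonion_def by (subst sum.swap) (simp only: scaleR_left.sum)
  then have "?d *\<^sub>R (\<Sum>l=0..n. trib_octonion V l) =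
      (\<Sum>j=0..7. (?d * (\<Sum>l=0..n. V (l + j))) *\<^sub>R oct_basis j)"
    by (simp only: scaleR_sum_right scaleR_scaleR)
  also have "\<dots> = trib_octonion V (n + 2) + (1 - r) *\<^sub>R trib_octonion V (n + 1)
      + t *\<^sub>R trib_octonion V n + trib_omega r s t V"
    unfolding tribonacci_window_sum[OF assms(1)] trib_omega_eq_sum trib_octonion_def
    by (simp only: scaleR_add_left sum.distrib scaleR_sum_right scaleR_scaleR)
  finally have "(1 / ?d) *\<^sub>R (?d *\<^sub>R (\<Sum>l=0..n. trib_octonion V l)) =
      (1 / ?d) *\<^sub>R (trib_octonion V (n + 2) + (1 - r) *\<^sub>R trib_octonion V (n + 1)
        + t *\<^sub>R trib_octonion V n + trib_omega r s t V)"
    by (rule arg_cong)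
  with assms(3) show ?thesis by simp
qed

end
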